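(* Let $\mathbf{H}$ be one of $\mathbf{Z}$, $\mathbf{N}$, $\mathbf{N}^+$, let $\mathscr{G}$ be a subset of the set of axioms $\mathscr{F}=\{\text{(F1)},\ldots,\text{(F5)}\}$, and let $(A,\le_A)$ be a non-empty directed preordered set. Let $(\mu_\alpha)_{\alpha\in A}$ and $(\lambda_\alpha)_{\alpha\in A}$ be pointwise convergent nets with values in $\mathcal{M}^\star(\mathscr{G})$ and $\mathcal{M}_\star(\mathscr{G})$, respectively, and denote by $\mu$ a pointwise limit of $(\mu_\alpha)_{\alpha\in A}$ and by $\lambda$ a pointwise limit of $(\lambda_\alpha)_{\alpha\in A}$. Then $\mu$ and $\lambda$ are uniquely determined and belong to $\mathcal{M}^\star(\mathscr{G})$ and $\mathcal{M}_\star(\mathscr{G})$, respectively.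
   Context: $\mathbf{N}$ is the set of non-negative integers, $\mathbf{N}^+$ the set of positive integers, $\mathcal{P}(\mathbf{H})$ the power set of $\mathbf{H}$; $k\cdot X:=\{kx:x\in X\}$, $X+h:=\{x+h:x\in X\}$, $X^c:=\mathbf{H}\setminus X$. Axioms for $\mu^\star:\mathcal{P}(\mathbf{H})\to\mathbf{R}$: (F1) $\mu^\star(\mathbf{H})=1$; (F2) $\mu^\star(X)\le\mu^\star(Y)$ whenever $X\subseteq Y\subseteq\mathbf{H}$; (F3) $\mu^\star(X\cup Y)\le\mu^\star(X)+\mu^\star(Y)$ for all $X,Y\subseteq\mathbf{H}$; (F4) $\mu^\star(k\cdot X)=\frac1k\mu^\star(X)$ for all $X\subseteq\mathbf{H}$, $k\in\mathbf{N}^+$; (F5) $\mu^\star(X+h)=\mu^\star(X)$ for all $X\subseteq\mathbf{H}$, $h\in\mathbf{N}$. $\mathcal{M}^\star(\mathscr{G})$ is the set of all functions $\mu^\star:\mathcal{P}(\mathbf{H})\to\mathbf{R}$ that satisfy all axioms in $\mathscr{G}$ and $\mathrm{Im}(\mu^\star)\subseteq[0,1]$. $\mathcal{M}_\star(\mathscr{G})$ is the set of the duals of the functions in $\mathcal{M}^\star(\mathscr{G})$, the dual of $\mu^\star$ being $\mu_\star:X\mapsto1-\mu^\star(X^c)$. A directed preordered set $(A,\le_A)$ is a set with a reflexive and transitive relation such that every non-empty finite $B\subseteq A$ has an upper bound in $A$. A net $(f_\alpha)_{\alpha\in A}$ of functions $S\to\mathbf{R}$ is pointwise convergent if there is $f:S\to\mathbf{R}$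 (a pointwise limit) such that, for every $x\in S$, the real net $(f_\alpha(x))_{\alpha\in A}$ converges to $f(x)$ in the usual topology of $\mathbf{R}$. *)

theory Defs
  imports "HOL-Analysis.Analysis"
begin

text \<open>A function from the power set of \<open>H\<close> to the reals is an element of
  \<open>extensional (Pow H)\<close>: it takes the value \<open>undefined\<close> outside \<open>Pow H\<close>, so that HOL equality of
  two such functions is equality on \<open>Pow H\<close>.\<close>

datatype axiom = F1 | F2 | F3 | F4 | F5

fun satisfies :: "int set \<Rightarrow> (int set \<Rightarrow> real) \<Rightarrow> axiom \<Rightarrow> bool" where
  "satisfies H \<mu> F1 \<longleftrightarrow> \<mu> H = 1"
| "satisfies H \<mu> F2 \<longleftrightarrow> (\<forall>X Y. X \<subseteq> Y \<and> Y \<subseteq> H \<longrightarrow> \<mu> X \<le> \<mu> Y)"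
| "satisfies H \<mu> F3 \<longleftrightarrow> (\<forall>X Y. X \<subseteq> H \<and> Y \<subseteq> H \<longrightarrow> \<mu> (X \<union> Y) \<le> \<mu> X + \<mu> Y)"
| "satisfies H \<mu> F4 \<longleftrightarrow>
     (\<forall>X (k::nat). X \<subseteq> H \<and> k \<ge> 1 \<longrightarrow> \<mu> ((\<lambda>x. int k * x) ` X) = 1 / real k * \<mu> X)"
| "satisfies H \<mu> F5 \<longleftrightarrow> (\<forall>X (h::nat). X \<subseteq> H \<longrightarrow> \<mu> ((\<lambda>x. x + int h) ` X) = \<mu> X)"

definition upper_M :: "int set \<Rightarrow> axiom set \<Rightarrow> (int set \<Rightarrow> real) set" where
  "upper_M H G =
     {\<mu> \<in> extensional (Pow H). (\<forall>F\<in>G. satisfies H \<mu> F) \<and> \<mu> ` Pow H \<subseteq> {0..1}}"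

definition dual :: "int set \<Rightarrow> (int set \<Rightarrow> real) \<Rightarrow> int set \<Rightarrow> real" where
  "dual H \<mu> = restrict (\<lambda>X. 1 - \<mu> (H - X)) (Pow H)"

definition lower_M :: "int set \<Rightarrow> axiom set \<Rightarrow> (int set \<Rightarrow> real) set" where
  "lower_M H G = dual H ` upper_M H G"

definition directed_preorder_on :: "'a set \<Rightarrow> ('a \<times> 'a) set \<Rightarrow> bool" where
  "directed_preorder_on A r \<longleftrightarrow> preorder_on A r \<and>
     (\<forall>B. B \<subseteq> A \<and> finite B \<and> B \<noteq> {} \<longrightarrow> (\<exists>u\<in>A. \<forall>b\<in>B. (b, u) \<in> r))"

text \<open>The filter of tails of a directed preordered set. A net indexed by \<open>A\<close> converges iff it
  converges along this filter; see \<open>tendsto_net_filter_iff\<close> for the usual formulation.\<close>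

definition net_filter :: "'a set \<Rightarrow> ('a \<times> 'a) set \<Rightarrow> 'a filter" where
  "net_filter A r = (INF a\<in>A. principal {b \<in> A. (a, b) \<in> r})"

lemma eventually_net_filter:
  assumes "A \<noteq> {}" "directed_preorder_on A r"
  shows "eventually P (net_filter A r) \<longleftrightarrow> (\<exists>a\<in>A. \<forall>b\<in>A. (a, b) \<in> r \<longrightarrow> P b)"
proof -
  have "\<exists>c\<in>A. principal {x \<in> A. (c, x) \<in> r} \<le>
      inf (principal {x \<in> A. (a, x) \<in> r}) (principal {x \<in> A. (b, x) \<in> r})"
    if "a \<in> A" "b \<in> A" for a b
  proof -
    have "{a, b} \<subseteq> A \<and> finite {a, b} \<and> {a, b} \<noteq> {}"
      using that by simp
    then obtain c where c: "c \<in> A" "(a, c) \<in> r" "(b, c) \<in> r"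
      using assms(2) unfolding directed_preorder_on_def by (metis insertCI)
    moreover have "trans r"
      using assms(2) by (simp add: directed_preorder_on_def preorder_on_def)
    ultimately have "{x \<in> A. (c, x) \<in> r} \<subseteq> {x \<in> A. (a, x) \<in> r} \<inter> {x \<in> A. (b, x) \<in> r}"
      by (blast dest: transD)
    with c show ?thesis by auto
  qed
  then have "eventually P (net_filter A r) \<longleftrightarrow>
      (\<exists>a\<in>A. eventually P (principal {b \<in> A. (a, b) \<in> r}))"
    unfolding net_filter_def using assms(1) by (intro eventually_INF_base) auto
  then show ?thesis
    by (auto simp: eventually_principal)
qed

lemma tendsto_net_filter_iff:
  assumes "A \<noteq> {}" "directed_preorder_on A r"
  shows "(f \<longlongrightarrow> l) (net_filter A r) \<longleftrightarrow>
    (\<forall>U. open U \<and> l \<in> U \<longrightarrow> (\<exists>a\<in>A. \<forall>b\<in>A. (a, b) \<in> r \<longrightarrow> f b \<in> U))"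
  by (auto simp: tendsto_def eventually_net_filter[OF assms])

definition pointwise_limit ::
  "'s set \<Rightarrow> 'a set \<Rightarrow> ('a \<times> 'a) set \<Rightarrow> ('a \<Rightarrow> 's \<Rightarrow> real) \<Rightarrow> ('s \<Rightarrow> real) \<Rightarrow> bool" where
  "pointwise_limit S A r f g \<longleftrightarrow>
     g \<in> extensional S \<and> (\<forall>x\<in>S. ((\<lambda>a. f a x) \<longlongrightarrow> g x) (net_filter A r))"

end

theory Submission
  imports Defs
begin

text \<open>Each of the axioms, and the requirement that values lie in the unit interval, is a family of
  non-strict inequalities and equalities, each relating the values of the function at finitely many
  subsets of \<open>H\<close>. Such conditions are closed in the topology of pointwise convergence, so they pass
  to limits of nets (\<open>satisfies_pointwise_limit\<close>, \<open>upper_M_pointwise_limit\<close>). Each of the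
  three choices of \<open>H\<close> is stable under dilations by positive integers and translations by
  non-negative ones, so both sides of (F4) and (F5) are evaluated at subsets of \<open>H\<close>, where
  convergence is known.

  Lower functions reduce to upper ones by duality: taking duals is continuous for pointwise
  convergence and is an involution, so it carries the closedness of \<open>upper_M\<close> over to \<open>lower_M\<close>.
  Uniqueness holds because \<open>\<real>\<close> is Hausdorff and the filter of tails of a non-empty directed set is
  proper.\<close>

lemma net_filter_neq_bot:
  assumes "A \<noteq> {}" "directed_preorder_on A r"
  shows "net_filter A r \<noteq> bot"
proof -
  have "refl_on A r"
    using assms(2) by (simp add: directed_preorder_on_def preorder_on_def)
  then show ?thesis
    by (auto simp: trivial_limit_def eventually_net_filter[OF assms] dest: refl_onD)
qed

lemma eventually_net_filter_in:
  assumes "A \<noteq> {}" "directed_preorder_on A r"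
  shows "eventually (\<lambda>a. a \<in> A) (net_filter A r)"
  using assms(1) by (auto simp: eventually_net_filter[OF assms])

lemma pointwise_limit_unique:
  assumes "A \<noteq> {}" "directed_preorder_on A r"
    and "pointwise_limit S A r f g" "pointwise_limit S A r f g'"
  shows "g = g'"
proof (rule extensionalityI[where A = S])
  show "g x = g' x" if "x \<in> S" for x
  proof (rule tendsto_unique[OF net_filter_neq_bot[OF assms(1,2)]])
    show "((\<lambda>a. f a x) \<longlongrightarrow> g x) (net_filter A r)" "((\<lambda>a. f a x) \<longlongrightarrow> g' x) (net_filter A r)"
      using assms(3,4) that by (auto simp: pointwise_limit_def)
  qed
qed (use assms(3,4) in \<open>auto simp: pointwise_limit_def\<close>)

text \<open>Every axiom compares values at fixed subsets of \<open>H\<close> by \<open>=\<close> or \<open>\<le>\<close>, through continuous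
  operations (addition, scaling); such a comparison, being true along the whole net, survives in the
  limit. The stability assumptions on \<open>H\<close> keep the dilated and translated sets inside \<open>H\<close>.\<close>

lemma satisfies_pointwise_limit:
  assumes dil: "\<And>x k. x \<in> H \<Longrightarrow> k \<ge> 1 \<Longrightarrow> int k * x \<in> H"
    and shift: "\<And>x h. x \<in> H \<Longrightarrow> x + int h \<in> H"
    and A: "A \<noteq> {}" "directed_preorder_on A r"
    and sat: "\<And>a. a \<in> A \<Longrightarrow> satisfies H (f a) F"
    and lim: "pointwise_limit (Pow H) A r f g"
  shows "satisfies H g F"
proof -
  note nontriv = net_filter_neq_bot[OF A]
  have conv: "((\<lambda>a. f a X) \<longlongrightarrow> g X) (net_filter A r)" if "X \<subseteq> H" for X
    using lim that by (simp add: pointwise_limit_def)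
  have ev: "eventually P (net_filter A r)" if "\<And>a. a \<in> A \<Longrightarrow> P a" for P
    using eventually_net_filter_in[OF A] that by (rule eventually_mono)
  have eq: "l = m"
    if "(u \<longlongrightarrow> l) (net_filter A r)" "(v \<longlongrightarrow> m) (net_filter A r)" "\<And>a. a \<in> A \<Longrightarrow> u a = v a"
    for u v :: "'a \<Rightarrow> real" and l m
  proof -
    have "(v \<longlongrightarrow> l) (net_filter A r)"
      using that(1) tendsto_cong[OF ev[of "\<lambda>a. u a = v a"]] that(3) by simp
    then show ?thesis
      using tendsto_unique[OF nontriv] that(2) by blast
  qed
  show ?thesis
  proof (cases F)
    case F1
    show ?thesis
      using eq[OF conv[of H] tendsto_const] sat F1 by simp
  next
    case F2
    have "g X \<le> g Y" if "X \<subseteq> Y" "Y \<subseteq> H" for X Y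
      using that sat F2 by (intro tendsto_le[OF nontriv conv conv ev]) auto
    then show ?thesis using F2 by simp
  next
    case F3
    have "g (X \<union> Y) \<le> g X + g Y" if "X \<subseteq> H" "Y \<subseteq> H" for X Y
      using that sat F3
      by (intro tendsto_le[OF nontriv tendsto_add[OF conv conv] conv ev]) auto
    then show ?thesis using F3 by simp
  next
    case F4
    have "g ((\<lambda>x. int k * x) ` X) = 1 / real k * g X" if "X \<subseteq> H" "k \<ge> 1" for X and k :: nat
      using that sat F4 dil
      by (intro eq[OF conv tendsto_mult_left[OF conv]]) auto
    then show ?thesis using F4 by simp
  next
    case F5
    have "g ((\<lambda>x. x + int h) ` X) = g X" if "X \<subseteq> H" for X and h :: nat
      using that sat F5 shift by (intro eq[OF conv conv]) auto
    then show ?thesis using F5 by simp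
  qed
qed

lemma upper_M_pointwise_limit:
  assumes dil: "\<And>x k. x \<in> H \<Longrightarrow> k \<ge> 1 \<Longrightarrow> int k * x \<in> H"
    and shift: "\<And>x h. x \<in> H \<Longrightarrow> x + int h \<in> H"
    and A: "A \<noteq> {}" "directed_preorder_on A r"
    and mem: "\<And>a. a \<in> A \<Longrightarrow> f a \<in> upper_M H G"
    and lim: "pointwise_limit (Pow H) A r f g"
  shows "g \<in> upper_M H G"
proof -
  have "satisfies H g F" if "F \<in> G" for F
    using mem that
    by (intro satisfies_pointwise_limit[OF dil shift A _ lim]) (auto simp: upper_M_def)
  moreover have "g X \<in> {0..1}" if "X \<in> Pow H" for X
  proof (rule Lim_in_closed_set[OF closed_atLeastAtMost _ net_filter_neq_bot[OF A]])
    show "eventually (\<lambda>a. f a X \<in> {0..1}) (net_filter A r)"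
      using eventually_net_filter_in[OF A]
      by (rule eventually_mono) (use mem that in \<open>auto simp: upper_M_def image_subset_iff\<close>)
    show "((\<lambda>a. f a X) \<longlongrightarrow> g X) (net_filter A r)"
      using lim that by (simp add: pointwise_limit_def)
  qed
  moreover have "g \<in> extensional (Pow H)"
    using lim by (simp add: pointwise_limit_def)
  ultimately show ?thesis
    by (auto simp: upper_M_def)
qed

lemma dual_dual:
  assumes "\<mu> \<in> extensional (Pow H)"
  shows "dual H (dual H \<mu>) = \<mu>"
proof (rule extensionalityI[OF _ assms])
  show "dual H (dual H \<mu>) X = \<mu> X" if "X \<in> Pow H" for X
    using that by (simp add: dual_def double_diff)
qed (simp add: dual_def)

text \<open>Since the dual is an involution, membership in the image \<open>lower_M\<close> is detected by the dual
  alone, without choosing a preimage. For a net of lower functions this gives a net of upper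
  functions whose limit is the dual of the original limit.\<close>

lemma lower_M_iff:
  assumes "\<mu> \<in> extensional (Pow H)"
  shows "\<mu> \<in> lower_M H G \<longleftrightarrow> dual H \<mu> \<in> upper_M H G"
proof
  assume "\<mu> \<in> lower_M H G"
  then obtain \<nu> where "\<nu> \<in> upper_M H G" "\<mu> = dual H \<nu>"
    by (auto simp: lower_M_def)
  then show "dual H \<mu> \<in> upper_M H G"
    by (simp add: dual_dual upper_M_def)
next
  assume "dual H \<mu> \<in> upper_M H G"
  then show "\<mu> \<in> lower_M H G"
    unfolding lower_M_def by (rule rev_image_eqI) (simp add: dual_dual assms)
qed

lemma lower_M_extensional: "\<mu> \<in> lower_M H G \<Longrightarrow> \<mu> \<in> extensional (Pow H)"
  by (auto simp: lower_M_def dual_def)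

lemma pointwise_limit_dual:
  assumes "pointwise_limit (Pow H) A r f g"
  shows "pointwise_limit (Pow H) A r (\<lambda>a. dual H (f a)) (dual H g)"
  using assms by (auto simp: pointwise_limit_def dual_def intro!: tendsto_diff)

theorem proposition13:
  fixes H :: "int set" and G :: "axiom set"
    and A :: "'a set" and r :: "('a \<times> 'a) set"
    and mus las :: "'a \<Rightarrow> int set \<Rightarrow> real"
    and mu la :: "int set \<Rightarrow> real"
  assumes "H \<in> {UNIV, {0..}, {1..}}"
    and "A \<noteq> {}" and "directed_preorder_on A r"
    and "\<forall>a\<in>A. mus a \<in> upper_M H G"
    and "\<forall>a\<in>A. las a \<in> lower_M H G"
    and "pointwise_limit (Pow H) A r mus mu"
    and "pointwise_limit (Pow H) A r las la"
  shows "(\<forall>g. pointwise_limit (Pow H) A r mus g \<longrightarrow> g = mu)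
    \<and> (\<forall>g. pointwise_limit (Pow H) A r las g \<longrightarrow> g = la)
    \<and> mu \<in> upper_M H G \<and> la \<in> lower_M H G"
proof -
  have dil: "int k * x \<in> H" if "x \<in> H" "k \<ge> 1" for x k
    using assms(1) that mult_mono[of 1 "int k" 1 x] by auto
  have shift: "x + int h \<in> H" if "x \<in> H" for x h
    using assms(1) that by auto
  have "mu \<in> upper_M H G"
    using assms(4) by (intro upper_M_pointwise_limit[OF dil shift assms(2,3) _ assms(6)]) auto
  moreover have "dual H la \<in> upper_M H G"
  proof (rule upper_M_pointwise_limit[OF dil shift assms(2,3) _ pointwise_limit_dual[OF assms(7)]])
    show "dual H (las a) \<in> upper_M H G" if "a \<in> A" for a
      using assms(5) that lower_M_iff lower_M_extensional by blast
  qed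
  then have "la \<in> lower_M H G"
    using assms(7) by (simp add: lower_M_iff pointwise_limit_def)
  ultimately show ?thesis
    using pointwise_limit_unique[OF assms(2,3)] assms(6,7) by blast
qed

end
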